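(* (Picone identity I.) Let $a<b$ with $[a,b]\subseteq\mathcal I$, and assume the Riccati equation $Rz=0$ has a solution $z$ on $[a,b]$. Then the conformable self-adjoint equation $Lx=0$ has a solution $x$ that is nonzero at every point of $[a,b]$, and for any admissible function $\eta\in\mathbb A$ the equality $$D^{\alpha}[z\eta^2]+\kappa_1z\eta^2=p(D^{\alpha}\eta)^2-q\eta^2-p\left(D^{\alpha}\eta-\frac{z\eta}{p}\right)^2$$ holds on $[a,b]$ (at every point where $\eta$ is differentiable).
   Context: $\mathcal I\subseteq\mathbb R$ is a nondegenerate interval. The functions $\kappa_0,\kappa_1:[0,1]\times\mathcal I\to[0,\infty)$ are continuous and satisfy, for all $t\in\mathcal I$: $\lim_{\alpha\to0^+}\kappa_1(\alpha,t)=1$, $\lim_{\alpha\to0^+}\kappa_0(\alpha,t)=0$, $\lim_{\alpha\to1^-}\kappa_1(\alpha,t)=0$, $\lim_{\alpha\to1^-}\kappa_0(\alpha,t)=1$, $\kappa_1(\alpha,t)\ne0$ for $\alpha\in[0,1)$, and $\kappa_0(\alpha,t)\neq0$ for $\alpha\in(0,1]$. Fix $\alpha\in(0,1]$ and write $\kappa_j(t)=\kappa_j(\alpha,t)$. The conformable (proportional) derivative is $D^{\alpha}f(t)=\kappa_1(t)f(t)+\kappa_0(t)f'(t)$ (one-sided at endpoints). Let $p,q$ be continuous on $\mathcal I$ with $p(t)>0$ for all $t\in\mathcal I$, and set $Lx=D^{\alpha}[pD^{\alpha}x]+qx$. A solution of $Lx=0$ on $[a,b]$ is a continuous function $x$ on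 $[a,b]$ such that $D^{\alpha}x$ and $D^{\alpha}[pD^{\alpha}x]$ exist and are continuous and $Lx=0$ on $[a,b]$. The Riccati operator is $Rz=D^{\alpha}z+q+\frac{z^2}{p}-\kappa_1z$; a solution of $Rz=0$ on $[a,b]$ is a differentiable function $z$ with $D^{\alpha}z$ continuous and $Rz=0$ on $[a,b]$. The set of admissible functions is $\mathbb A=\{\eta\in C^1([a,b],\mathbb R)\setminus\{0\}:\eta(a)=\eta(b)=0\}$, where here $C^1([a,b],\mathbb R)$ denotes the continuous functions on $[a,b]$ whose ordinary derivative is piecewise continuous. *)

theory Defs
  imports "HOL-Analysis.Analysis"
begin

definition conformable_kernels ::
    "real set \<Rightarrow> (real \<Rightarrow> real \<Rightarrow> real) \<Rightarrow> (real \<Rightarrow> real \<Rightarrow> real) \<Rightarrow> bool" where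
  "conformable_kernels I \<kappa>0 \<kappa>1 \<longleftrightarrow>
     continuous_on ({0..1} \<times> I) (\<lambda>(\<alpha>, t). \<kappa>0 \<alpha> t) \<and>
     continuous_on ({0..1} \<times> I) (\<lambda>(\<alpha>, t). \<kappa>1 \<alpha> t) \<and>
     (\<forall>\<alpha>\<in>{0..1}. \<forall>t\<in>I. 0 \<le> \<kappa>0 \<alpha> t \<and> 0 \<le> \<kappa>1 \<alpha> t) \<and>
     (\<forall>t\<in>I.
        ((\<lambda>\<alpha>. \<kappa>1 \<alpha> t) \<longlongrightarrow> 1) (at_right 0) \<and>
        ((\<lambda>\<alpha>. \<kappa>0 \<alpha> t) \<longlongrightarrow> 0) (at_right 0) \<and>
        ((\<lambda>\<alpha>. \<kappa>1 \<alpha> t) \<longlongrightarrow> 0) (at_left 1) \<and>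
        ((\<lambda>\<alpha>. \<kappa>0 \<alpha> t) \<longlongrightarrow> 1) (at_left 1) \<and>
        (\<forall>\<alpha>\<in>{0..<1}. \<kappa>1 \<alpha> t \<noteq> 0) \<and>
        (\<forall>\<alpha>\<in>{0<..1}. \<kappa>0 \<alpha> t \<noteq> 0))"

text \<open>
  From here on the order \<open>\<alpha>\<close> is fixed and \<open>k0\<close>, \<open>k1\<close> stand for \<open>\<kappa>0 \<alpha>\<close>, \<open>\<kappa>1 \<alpha>\<close>.
  The derivative is taken within \<open>S\<close>, so for \<open>S = {a..b}\<close> it is one-sided at \<open>a\<close> and \<open>b\<close>.
  The value is meaningful only where \<open>f\<close> is differentiable within \<open>S\<close>; since \<open>k0\<close> has no
  zeros, this is exactly where the conformable derivative exists, and differentiability is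
  always required separately below.
\<close>

definition conf_deriv ::
    "(real \<Rightarrow> real) \<Rightarrow> (real \<Rightarrow> real) \<Rightarrow> real set \<Rightarrow> (real \<Rightarrow> real) \<Rightarrow> real \<Rightarrow> real" where
  "conf_deriv k0 k1 S f t = k1 t * f t + k0 t * vector_derivative f (at t within S)"

lemma conf_deriv_eq:
  assumes "(f has_real_derivative f') (at t within {a..b})" "a < b" "t \<in> {a..b}"
  shows "conf_deriv k0 k1 {a..b} f t = k1 t * f t + k0 t * f'"
proof -
  have "vector_derivative f (at t within cbox a b) = f'"
    by (rule vector_derivative_within_cbox)
      (use assms in \<open>auto simp: has_real_derivative_iff_has_vector_derivative\<close>)
  then show ?thesis by (simp add: conf_deriv_def)
qed

definition L_op ::
    "(real \<Rightarrow> real) \<Rightarrow> (real \<Rightarrow> real) \<Rightarrow> (real \<Rightarrow> real) \<Rightarrow> (real \<Rightarrow> real) \<Rightarrow> real set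
      \<Rightarrow> (real \<Rightarrow> real) \<Rightarrow> real \<Rightarrow> real" where
  "L_op k0 k1 p q S x t =
     conf_deriv k0 k1 S (\<lambda>s. p s * conf_deriv k0 k1 S x s) t + q t * x t"

definition L_solution ::
    "(real \<Rightarrow> real) \<Rightarrow> (real \<Rightarrow> real) \<Rightarrow> (real \<Rightarrow> real) \<Rightarrow> (real \<Rightarrow> real) \<Rightarrow> real \<Rightarrow> real
      \<Rightarrow> (real \<Rightarrow> real) \<Rightarrow> bool" where
  "L_solution k0 k1 p q a b x \<longleftrightarrow>
     continuous_on {a..b} x \<and>
     x differentiable_on {a..b} \<and>
     continuous_on {a..b} (conf_deriv k0 k1 {a..b} x) \<and>
     (\<lambda>s. p s * conf_deriv k0 k1 {a..b} x s) differentiable_on {a..b} \<and>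
     continuous_on {a..b} (conf_deriv k0 k1 {a..b} (\<lambda>s. p s * conf_deriv k0 k1 {a..b} x s)) \<and>
     (\<forall>t\<in>{a..b}. L_op k0 k1 p q {a..b} x t = 0)"

definition R_op ::
    "(real \<Rightarrow> real) \<Rightarrow> (real \<Rightarrow> real) \<Rightarrow> (real \<Rightarrow> real) \<Rightarrow> (real \<Rightarrow> real) \<Rightarrow> real set
      \<Rightarrow> (real \<Rightarrow> real) \<Rightarrow> real \<Rightarrow> real" where
  "R_op k0 k1 p q S z t =
     conf_deriv k0 k1 S z t + q t + (z t)\<^sup>2 / p t - k1 t * z t"

definition R_solution ::
    "(real \<Rightarrow> real) \<Rightarrow> (real \<Rightarrow> real) \<Rightarrow> (real \<Rightarrow> real) \<Rightarrow> (real \<Rightarrow> real) \<Rightarrow> real \<Rightarrow> real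
      \<Rightarrow> (real \<Rightarrow> real) \<Rightarrow> bool" where
  "R_solution k0 k1 p q a b z \<longleftrightarrow>
     z differentiable_on {a..b} \<and>
     continuous_on {a..b} (conf_deriv k0 k1 {a..b} z) \<and>
     (\<forall>t\<in>{a..b}. R_op k0 k1 p q {a..b} z t = 0)"

text \<open>
  Piecewise continuity on \<open>[a,b]\<close> with exceptional set \<open>E\<close>: jump discontinuities only, i.e. all
  one-sided limits exist and are finite. Values of \<open>g\<close> on \<open>E\<close> are irrelevant, so \<open>g\<close> may be
  a derivative that does not exist there.
\<close>

definition piecewise_continuous_off :: "real set \<Rightarrow> real \<Rightarrow> real \<Rightarrow> (real \<Rightarrow> real) \<Rightarrow> bool" where
  "piecewise_continuous_off E a b g \<longleftrightarrow>
     finite E \<and>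
     continuous_on ({a..b} - E) g \<and>
     (\<forall>t\<in>{a..<b}. \<exists>l. (g \<longlongrightarrow> l) (at_right t)) \<and>
     (\<forall>t\<in>{a<..b}. \<exists>l. (g \<longlongrightarrow> l) (at_left t))"

definition piecewise_C1 :: "real \<Rightarrow> real \<Rightarrow> (real \<Rightarrow> real) \<Rightarrow> bool" where
  "piecewise_C1 a b \<eta> \<longleftrightarrow>
     continuous_on {a..b} \<eta> \<and>
     (\<exists>E g. piecewise_continuous_off E a b g \<and>
        (\<forall>t\<in>{a..b} - E. (\<eta> has_real_derivative g t) (at t within {a..b})))"

definition admissible :: "real \<Rightarrow> real \<Rightarrow> (real \<Rightarrow> real) set" where
  "admissible a b =
     {\<eta>. piecewise_C1 a b \<eta> \<and> (\<exists>t\<in>{a..b}. \<eta> t \<noteq> 0) \<and> \<eta> a = 0 \<and> \<eta> b = 0}"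

end

theory Submission
  imports Defs
begin

text \<open>
  A solution \<open>z\<close> of the Riccati equation should be \<open>p D x / x\<close>, i.e. \<open>D x = (z / p) x\<close>, which is
  the first-order linear equation \<open>x' = w x\<close> with \<open>w = (z / p - \<kappa>\<^sub>1) / \<kappa>\<^sub>0\<close>. Its solution
  \<open>x = exp (\<integral> w)\<close> has no zeros, and \<open>D [p D x] = D [z x] = x (D z + z\<^sup>2 / p - \<kappa>\<^sub>1 z) = - q x\<close>.
  The Picone identity follows from the product rule on eliminating \<open>q\<close> by the Riccati equation.
\<close>

text \<open>Joint continuity is composed with the embedding of \<open>I\<close> at height \<alpha>.
  Since \<alpha> > 0, the kernel \<open>\<kappa>0 \<alpha>\<close> has no zeros, which permits
  dividing by it later.\<close>

lemma conformable_kernel_sections: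
  assumes "conformable_kernels I \<kappa>0 \<kappa>1" "\<alpha> \<in> {0<..1}"
  shows "continuous_on I (\<kappa>0 \<alpha>)" "continuous_on I (\<kappa>1 \<alpha>)" "\<And>t. t \<in> I \<Longrightarrow> \<kappa>0 \<alpha> t \<noteq> 0"
proof -
  have sect: "continuous_on I (f \<alpha>)"
    if "continuous_on ({0..1} \<times> I) (\<lambda>(\<alpha>, t). f \<alpha> t)" for f :: "real \<Rightarrow> real \<Rightarrow> real"
  proof -
    have "continuous_on I (\<lambda>t. (\<lambda>(\<alpha>, t). f \<alpha> t) (\<alpha>, t))"
      by (rule continuous_on_compose2[OF that]) (use assms(2) in \<open>auto intro!: continuous_intros\<close>)
    then show ?thesis by simp
  qed
  show "continuous_on I (\<kappa>0 \<alpha>)" "continuous_on I (\<kappa>1 \<alpha>)" "\<And>t. t \<in> I \<Longrightarrow> \<kappa>0 \<alpha> t \<noteq> 0"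
    using assms sect by (auto simp: conformable_kernels_def)
qed

text \<open>The summand \<open>k1 t * z t\<close> of the conformable derivative cancels the last
  term of \<open>R_op\<close>. What remains expresses \<open>q\<close> through \<open>z\<close> and
  its ordinary derivative.\<close>

lemma R_solution_riccati_eq:
  assumes "R_solution k0 k1 p q a b z" "a < b" "t \<in> {a..b}"
    and "(z has_real_derivative z') (at t within {a..b})"
  shows "k0 t * z' + q t + (z t)\<^sup>2 / p t = 0"
  using assms(1,3) conf_deriv_eq[OF assms(4,2,3), of k0 k1]
  by (force simp: R_solution_def R_op_def)

lemma R_solution_imp_L_solution:
  assumes ab: "a < b"
    and k0: "continuous_on {a..b} k0" "\<And>t. t \<in> {a..b} \<Longrightarrow> k0 t \<noteq> 0"
    and k1: "continuous_on {a..b} k1"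
    and p: "continuous_on {a..b} p" "\<And>t. t \<in> {a..b} \<Longrightarrow> p t \<noteq> 0"
    and q: "continuous_on {a..b} q"
    and R: "R_solution k0 k1 p q a b z"
  obtains x where "L_solution k0 k1 p q a b x" "\<And>t. x t \<noteq> 0"
proof -
  have zd: "z differentiable_on {a..b}"
    using R by (simp add: R_solution_def)
  define w where "w t = (z t / p t - k1 t) / k0 t" for t
  define x where "x t = exp (integral {a..t} w)" for t
  have "continuous_on {a..b} w"
    unfolding w_def
    using k0 k1 p differentiable_imp_continuous_on[OF zd] by (auto intro!: continuous_intros)
  \<comment> \<open>Fundamental theorem of calculus within the interval, one-sided at the endpoints,
    and the chain rule for exp.\<close>
  then have x': "(x has_real_derivative w t * x t) (at t within {a..b})" if "t \<in> {a..b}" for t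
    unfolding x_def using integral_has_real_derivative[of a b w t] that
    by (auto intro!: derivative_eq_intros)
  have xd: "x differentiable_on {a..b}"
    using x' unfolding differentiable_on_def real_differentiable_def by blast
  have xc: "continuous_on {a..b} x"
    by (rule differentiable_imp_continuous_on[OF xd])
  have Dx: "conf_deriv k0 k1 {a..b} x t = z t / p t * x t" if "t \<in> {a..b}" for t
    using conf_deriv_eq[OF x'[OF that] ab that, of k0 k1] k0(2)[OF that]
    by (simp add: w_def field_simps)
  define y where "y s = p s * conf_deriv k0 k1 {a..b} x s" for s
  have y: "y t = z t * x t" if "t \<in> {a..b}" for t
    using Dx[OF that] p(2)[OF that] by (simp add: y_def)
  \<comment> \<open>One witness \<open>d\<close> serves twice: it gives the differentiability of
    \<open>y\<close>, and it turns the equation into the value of the conformable derivative of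
    \<open>y\<close>.\<close>
  have y': "\<exists>d. (y has_real_derivative d) (at t within {a..b}) \<and> k1 t * y t + k0 t * d = - (q t * x t)"
    if t: "t \<in> {a..b}" for t
  proof -
    obtain z' where z': "(z has_real_derivative z') (at t within {a..b})"
      using zd t unfolding differentiable_on_def real_differentiable_def by blast
    have "((\<lambda>s. z s * x s) has_real_derivative (z' + z t * w t) * x t) (at t within {a..b})"
      using z' x'[OF t] by (auto intro!: derivative_eq_intros simp: algebra_simps)
    then have "(y has_real_derivative (z' + z t * w t) * x t) (at t within {a..b})"
      \<comment> \<open>\<open>y\<close> agrees with \<open>z * x\<close> on all of
        \<open>{a..b}\<close>, so any positive radius would do.\<close>
      by (rule has_field_derivative_transform_within[OF _ zero_less_one t]) (simp add: y)
    moreover have "k1 t * y t + k0 t * ((z' + z t * w t) * x t) = - (q t * x t)"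
    proof -
      have q: "q t = - (k0 t * z' + (z t)\<^sup>2 / p t)"
        using R_solution_riccati_eq[OF R ab t z'] by simp
      have w: "k1 t + k0 t * w t = z t / p t"
        using k0(2)[OF t] by (simp add: w_def)
      \<comment> \<open>This is the conformable derivative of \<open>z * x\<close> with the factor
        \<open>x t\<close> removed. The grouping exposes \<open>k1 t + k0 t * w t\<close>, which
        equals \<open>z t / p t\<close> by the choice of \<open>w\<close>.\<close>
      have "k1 t * z t + k0 t * (z' + z t * w t) = k0 t * z' + (k1 t + k0 t * w t) * z t"
        by (simp add: algebra_simps)
      then have "k1 t * z t + k0 t * (z' + z t * w t) = k0 t * z' + (z t)\<^sup>2 / p t"
        unfolding w by (simp add: power2_eq_square)
      then show ?thesis
        unfolding q y[OF t] by (metis (no_types) add.inverse_inverse distrib_right mult.assoc mult_minus_left)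
    qed
    ultimately show ?thesis by blast
  qed
  have yd: "y differentiable_on {a..b}"
    using y' by (fastforce simp: differentiable_on_def real_differentiable_def)
  have Dy: "conf_deriv k0 k1 {a..b} y t = - (q t * x t)" if "t \<in> {a..b}" for t
    using y'[OF that] conf_deriv_eq[OF _ ab that] by metis
  have "continuous_on {a..b} (\<lambda>t. z t / p t * x t)"
    using p xc differentiable_imp_continuous_on[OF zd] by (auto intro!: continuous_intros)
  \<comment> \<open>Continuity is carried over from the closed form that the conformable derivative
    takes on \<open>{a..b}\<close>.\<close>
  then have "continuous_on {a..b} (conf_deriv k0 k1 {a..b} x)"
    by (rule continuous_on_eq) (simp only: Dx)
  moreover have "continuous_on {a..b} (\<lambda>t. - (q t * x t))"
    using q xc by (intro continuous_intros)
  then have "continuous_on {a..b} (conf_deriv k0 k1 {a..b} y)"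
    by (rule continuous_on_eq) (simp only: Dy)
  ultimately have "L_solution k0 k1 p q a b x"
    using xc xd yd Dy unfolding L_solution_def L_op_def y_def by simp
  moreover have "x t \<noteq> 0" for t
    by (simp add: x_def)
  ultimately show ?thesis by (rule that)
qed

text \<open>With D the conformable derivative, both sides equal 2 z \<eta> D\<eta> + \<kappa>0 z'
  \<eta>^2. On the left, the two terms \<kappa>1 z \<eta>^2 complete 2 z \<eta> \<kappa>0 \<eta>' to
  2 z \<eta> D\<eta>. On the right, expanding the square cancels p (D\<eta>)^2 and leaves -(q +
  z^2/p) \<eta>^2, which the Riccati equation turns into \<kappa>0 z' \<eta>^2.\<close>

lemma R_solution_picone_identity:
  assumes ab: "a < b" and t: "t \<in> {a..b}" and p: "p t \<noteq> 0"
    and R: "R_solution k0 k1 p q a b z"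
    and \<eta>: "\<eta> differentiable (at t within {a..b})"
  shows "(\<lambda>s. z s * (\<eta> s)\<^sup>2) differentiable (at t within {a..b})" (is ?diff)
    and "conf_deriv k0 k1 {a..b} (\<lambda>s. z s * (\<eta> s)\<^sup>2) t + k1 t * z t * (\<eta> t)\<^sup>2 =
      p t * (conf_deriv k0 k1 {a..b} \<eta> t)\<^sup>2 - q t * (\<eta> t)\<^sup>2
      - p t * (conf_deriv k0 k1 {a..b} \<eta> t - z t * \<eta> t / p t)\<^sup>2" (is ?identity)
proof -
  obtain z' where z': "(z has_real_derivative z') (at t within {a..b})"
    using R t unfolding R_solution_def differentiable_on_def real_differentiable_def by blast
  obtain e where e: "(\<eta> has_real_derivative e) (at t within {a..b})"
    using \<eta> unfolding real_differentiable_def by blast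
  have prod: "((\<lambda>s. z s * (\<eta> s)\<^sup>2) has_real_derivative z' * (\<eta> t)\<^sup>2 + 2 * z t * \<eta> t * e)
      (at t within {a..b})"
    using z' e by (auto intro!: derivative_eq_intros)
  then show ?diff
    by (auto simp: real_differentiable_def)
  have q: "q t = - (k0 t * z' + (z t)\<^sup>2 / p t)"
    using R_solution_riccati_eq[OF R ab t z'] by simp
  show ?identity
    unfolding conf_deriv_eq[OF prod ab t] conf_deriv_eq[OF e ab t] q
    using p by (simp add: field_simps power2_eq_square)
qed

theorem theorem7p3:
  fixes I :: "real set" and \<kappa>0 \<kappa>1 :: "real \<Rightarrow> real \<Rightarrow> real"
    and \<alpha> a b :: real and p q z :: "real \<Rightarrow> real"
  assumes "is_interval I" and "\<exists>s\<in>I. \<exists>t\<in>I. s \<noteq> t"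
    and "conformable_kernels I \<kappa>0 \<kappa>1"
    and "\<alpha> \<in> {0<..1}"
    and "continuous_on I p" and "continuous_on I q" and "\<forall>t\<in>I. p t > 0"
    and "a < b" and "{a..b} \<subseteq> I"
    and "R_solution (\<kappa>0 \<alpha>) (\<kappa>1 \<alpha>) p q a b z"
  shows "(\<exists>x. L_solution (\<kappa>0 \<alpha>) (\<kappa>1 \<alpha>) p q a b x \<and> (\<forall>t\<in>{a..b}. x t \<noteq> 0)) \<and>
    (\<forall>\<eta>\<in>admissible a b. \<forall>t\<in>{a..b}. \<eta> differentiable (at t within {a..b}) \<longrightarrow>
      (\<lambda>s. z s * (\<eta> s)\<^sup>2) differentiable (at t within {a..b}) \<and>
      conf_deriv (\<kappa>0 \<alpha>) (\<kappa>1 \<alpha>) {a..b} (\<lambda>s. z s * (\<eta> s)\<^sup>2) t + \<kappa>1 \<alpha> t * z t * (\<eta> t)\<^sup>2 =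
        p t * (conf_deriv (\<kappa>0 \<alpha>) (\<kappa>1 \<alpha>) {a..b} \<eta> t)\<^sup>2 - q t * (\<eta> t)\<^sup>2
        - p t * (conf_deriv (\<kappa>0 \<alpha>) (\<kappa>1 \<alpha>) {a..b} \<eta> t - z t * \<eta> t / p t)\<^sup>2)"
proof -
  note sub = continuous_on_subset[OF _ \<open>{a..b} \<subseteq> I\<close>]
  note k = conformable_kernel_sections[OF \<open>conformable_kernels I \<kappa>0 \<kappa>1\<close> \<open>\<alpha> \<in> {0<..1}\<close>]
  have k0: "\<kappa>0 \<alpha> t \<noteq> 0" and p: "p t \<noteq> 0" if "t \<in> {a..b}" for t
    using that k(3) assms(7,9) by force+
  obtain x where "L_solution (\<kappa>0 \<alpha>) (\<kappa>1 \<alpha>) p q a b x" "\<And>t. x t \<noteq> 0"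
    using R_solution_imp_L_solution[OF \<open>a < b\<close> sub[OF k(1)] k0 sub[OF k(2)] sub[OF assms(5)] p
        sub[OF assms(6)] assms(10)] by blast
  moreover note R_solution_picone_identity[where p = p, OF \<open>a < b\<close> _ p assms(10)]
  ultimately show ?thesis by blast
qed

end
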